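(* Let $\theta>0$ and $\beta=(\beta_0,\beta_1)^T\in\mathbb{R}^2$ be fixed. For each sample size $n\ge 2$ let $x=x^{(n)}=(x_1,\dots,x_n)\in\mathbb{R}^n$ be a deterministic vector (possibly depending on $n$) not collinear with $(1,\dots,1)^T$, let $\epsilon=(\epsilon_1,\dots,\epsilon_n)^T$ have independent components uniformly distributed on $[-\theta,\theta]$, let $Y=X\beta+\epsilon$ with $X=[1,x]$, and let $\hat\beta=(\hat\beta_0,\hat\beta_1)^T=(X^TX)^{-1}X^TY$. Put $S_1=\sum_{i=1}^n x_i$, $S_2=\sum_{i=1}^n x_i^2$, $d=nS_2-S_1^2$, $p_k=S_2-x_kS_1$ and $p'_k=nx_k-S_1$ for $1\le k\le n$. (1) If $\dfrac{\max_{1\le i\le n}|p_i|}{\sqrt{d\,S_2}}\to 0$ as $n\to+\infty$, then $\sqrt{\dfrac{d}{S_2}}\,(\hat\beta_0-\beta_0)$ converges in law to the normal distribution $N\!\left(0,\frac{\theta^2}{3}\right)$. (2) If $\dfrac{\max_{1\le i\le n}|p'_i|}{\sqrt{d\,n}}\to 0$ as $n\to+\infty$, then $\sqrt{\dfrac{d}{n}}\,(\hat\beta_1-\beta_1)$ converges in law to the normal distribution $N\!\left(0,\frac{\theta^2}{3}\right)$.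
   Context: $X=[1,x]$ denotes the $n\times 2$ matrix whose first column is $(1,\dots,1)^T$ and whose second column is $x$. The quantities $X$, $Y$, $\hat\beta$, $S_1$, $S_2$, $d$, $p_k$, $p'_k$ all depend on $n$. $N(m,s)$ is the normal law with mean $m$ and variance $s$. *)

theory Defs
  imports
    "HOL-Probability.Probability"
    "Jordan_Normal_Form.Gauss_Jordan_Elimination"
begin

unbundle no vec_syntax
hide_const (open) Finite_Cartesian_Product.vec Finite_Cartesian_Product.mat
  Finite_Cartesian_Product.transpose

text \<open>
  Since the sample size \<open>n\<close> varies in the statement, vectors and matrices are those with
  explicit dimensions. Indices start at \<open>0\<close>: the component \<open>x\<^sub>k\<close>, \<open>1 \<le> k \<le> n\<close>, of \<open>x\<close> is
  \<open>x $ (k - 1)\<close>, and \<open>(\<beta>\<^sub>0, \<beta>\<^sub>1)\<close> is \<open>(\<beta> $ 0, \<beta> $ 1)\<close>. The sample size is \<open>dim_vec x\<close>.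
\<close>

definition ones_vec :: "nat \<Rightarrow> real vec" where
  "ones_vec n = vec n (\<lambda>_. 1)"

definition design_mat :: "real vec \<Rightarrow> real mat" where
  "design_mat x = mat_of_cols (dim_vec x) [ones_vec (dim_vec x), x]"

text \<open>
  \<open>mat_inverse\<close> returns \<open>None\<close> on singular matrices, so \<open>ols_estimator\<close> is unspecified if
  \<open>X\<^sup>TX\<close> is singular. For \<open>X = design_mat x\<close> this happens only if \<open>x\<close> is a multiple of
  \<open>ones_vec (dim_vec x)\<close>.
\<close>
definition ols_estimator :: "real mat \<Rightarrow> real vec \<Rightarrow> real vec" where
  "ols_estimator X Y = (the (mat_inverse (X\<^sup>T * X)) * X\<^sup>T) *\<^sub>v Y"

definition S1 :: "real vec \<Rightarrow> real" where
  "S1 x = (\<Sum>i<dim_vec x. x $ i)"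

definition S2 :: "real vec \<Rightarrow> real" where
  "S2 x = (\<Sum>i<dim_vec x. (x $ i)\<^sup>2)"

definition d_coef :: "real vec \<Rightarrow> real" where
  "d_coef x = real (dim_vec x) * S2 x - (S1 x)\<^sup>2"

definition p_coef :: "real vec \<Rightarrow> nat \<Rightarrow> real" where
  "p_coef x k = S2 x - x $ k * S1 x"

definition p'_coef :: "real vec \<Rightarrow> nat \<Rightarrow> real" where
  "p'_coef x k = real (dim_vec x) * x $ k - S1 x"

text \<open>
  The second parameter of \<open>normal_law\<close> is the variance, that of \<open>normal_density\<close> the standard
  deviation.
\<close>
definition normal_law :: "real \<Rightarrow> real \<Rightarrow> real measure" where
  "normal_law m s = density lborel (normal_density m (sqrt s))"

text \<open>The random variables of the sequence may live on different probability spaces.\<close>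
definition converges_in_law ::
    "(nat \<Rightarrow> 'a measure) \<Rightarrow> (nat \<Rightarrow> 'a \<Rightarrow> real) \<Rightarrow> real measure \<Rightarrow> bool" where
  "converges_in_law M Z L \<longleftrightarrow> weak_conv_m (\<lambda>n. distr (M n) borel (Z n)) L"

end

theory Submission
  imports Defs
begin

text \<open>
  By Cramer's rule, both estimation errors are linear in the noise:
  \<open>\<beta>\<^sub>0\<close> is missed by \<open>(\<Sum>k. p\<^sub>k \<epsilon>\<^sub>k) / d\<close> and \<open>\<beta>\<^sub>1\<close> by \<open>(\<Sum>k. p'\<^sub>k \<epsilon>\<^sub>k) / d\<close>. Since
  \<open>\<Sum>k. p\<^sub>k\<^sup>2 = d S\<^sub>2\<close> and \<open>\<Sum>k. p'\<^sub>k\<^sup>2 = d n\<close>, the normalised errors are weighted sums of the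
  \<open>\<epsilon>\<^sub>k\<close> whose squared weights sum to \<open>1\<close> and whose largest weight tends to \<open>0\<close>. For such sums
  of i.i.d. variables the product of the characteristic functions converges to that of the normal
  law, and Levy's continuity theorem applies.
\<close>

section \<open>A central limit theorem for weighted sums\<close>

text \<open>Scaling carries the known characteristic function of the standard normal law over to
  variance \<open>s\<close>; hence the \<open>sqrt s\<close> here.\<close>

lemma normal_law_eq_distr_std:
  assumes "s > 0"
  shows "normal_law 0 s = distr std_normal_distribution borel (\<lambda>x. sqrt s * x)"
proof -
  interpret N: real_distribution std_normal_distribution
    by (rule real_dist_normal_dist)
  have "distributed std_normal_distribution lborel (\<lambda>x. x) std_normal_density"
    by (auto simp: distributed_def distr_id2)
  from N.normal_density_affine[OF this, of "sqrt s" 0]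
  have "distributed std_normal_distribution lborel (\<lambda>x. sqrt s * x) (normal_density 0 (sqrt s))"
    using assms by simp
  then have "distr std_normal_distribution lborel (\<lambda>x. sqrt s * x) = normal_law 0 s"
    unfolding distributed_def normal_law_def by simp
  then show ?thesis
    by (metis distr_cong sets_lborel)
qed

lemma real_distribution_normal_law:
  assumes "s > 0"
  shows "real_distribution (normal_law 0 s)"
proof -
  interpret N: real_distribution std_normal_distribution
    by (rule real_dist_normal_dist)
  show ?thesis
    unfolding normal_law_eq_distr_std[OF assms] by (rule N.real_distribution_distr) simp
qed

lemma char_distr_mult:
  assumes "X \<in> borel_measurable M"
  shows "char (distr M borel (\<lambda>\<omega>. a * X \<omega>)) t = char (distr M borel X) (t * a)"
  using assms by (simp add: char_def integral_distr mult_ac)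

lemma char_normal_law:
  assumes "s > 0"
  shows "char (normal_law 0 s) t = exp (- (s * t\<^sup>2 / 2))"
proof -
  have "char (normal_law 0 s) t = char std_normal_distribution (t * sqrt s)"
    using char_distr_mult[of "\<lambda>x. x" std_normal_distribution "sqrt s" t]
    by (simp add: normal_law_eq_distr_std[OF assms] char_def integral_distr mult_ac)
  then show ?thesis
    using assms by (simp add: char_std_normal_distribution power_mult_distrib mult_ac exp_of_real)
qed

text \<open>The lower bound is convexity, \<open>exp (- u) \<ge> 1 - u\<close>. The upper one
  follows from \<open>exp u \<ge> 1 + u\<close> and (1 + u)(1 - u + u^2) = 1 + u^3 \<ge> 1.\<close>

lemma exp_minus_approx:
  fixes u :: real
  assumes "u \<ge> 0"
  shows "\<bar>exp (- u) - (1 - u)\<bar> \<le> u\<^sup>2"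
proof -
  have "exp (- u) \<le> 1 / (1 + u)"
    using exp_ge_add_one_self[of u] assms by (simp add: exp_minus field_simps)
  also have "\<dots> \<le> 1 - u + u\<^sup>2"
    using assms by (simp add: field_simps power2_eq_square)
  finally show ?thesis
    using exp_ge_add_one_self[of "- u"] by simp
qed

text \<open>
  Lindeberg's condition holds because \<open>b n\<close> dominates the weights. Both characteristic functions
  are products of factors of norm at most \<open>1\<close>, and each factor is compared with
  \<open>1 - s * (t * a n i)\<^sup>2 / 2\<close>.
\<close>
theorem weighted_sum_clt:
  fixes M :: "nat \<Rightarrow> 'a measure" and X :: "nat \<Rightarrow> 'i \<Rightarrow> 'a \<Rightarrow> real"
    and a :: "nat \<Rightarrow> 'i \<Rightarrow> real" and b :: "nat \<Rightarrow> real" and s :: real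
  assumes prob: "\<And>n. prob_space (M n)"
    and indep: "\<And>n. prob_space.indep_vars (M n) (\<lambda>_. borel) (X n) (I n)"
    and distr: "\<And>n i. i \<in> I n \<Longrightarrow> distr (M n) borel (X n i) = \<mu>"
    and real_distr: "real_distribution \<mu>"
    and sq_int: "integrable \<mu> (\<lambda>x. x\<^sup>2)"
    and mean: "(LINT x|\<mu>. x) = 0"
    and var: "(LINT x|\<mu>. x\<^sup>2) = s"
    and s: "s > 0"
    and weights: "\<And>n. (\<Sum>i\<in>I n. (a n i)\<^sup>2) = 1"
    and bound: "\<And>n i. i \<in> I n \<Longrightarrow> \<bar>a n i\<bar> \<le> b n"
    and b: "b \<longlonglongrightarrow> 0"
  shows "weak_conv_m (\<lambda>n. distr (M n) borel (\<lambda>\<omega>. \<Sum>i\<in>I n. a n i * X n i \<omega>)) (normal_law 0 s)"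
proof (rule levy_continuity)
  interpret \<mu>: real_distribution \<mu> by (rule real_distr)
  have [measurable]: "X n i \<in> borel_measurable (M n)" if "i \<in> I n" for n i
    using indep[of n] that by (simp add: prob_space.indep_vars_def2[OF prob])
  show "real_distribution (distr (M n) borel (\<lambda>\<omega>. \<Sum>i\<in>I n. a n i * X n i \<omega>))" for n
    by (rule prob_space.real_distribution_distr[OF prob]) measurable
  show "real_distribution (normal_law 0 s)"
    by (rule real_distribution_normal_law[OF s])
  have int1: "integrable \<mu> (\<lambda>x. x)"
    by (rule \<mu>.square_integrable_imp_integrable) (use sq_int in auto)
  fix t
  \<comment> \<open>\<open>E \<bar>v\<bar>\<close> is the expectation in the remainder of the
    second-order expansion of \<open>char \<mu> v\<close>. The cubic term makes it small for small
    \<open>c\<close>; the quadratic term keeps it integrable, since no third moment is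
    assumed.\<close>
  define E where "E c = (LINT x|\<mu>. min (6 * x\<^sup>2) (c * \<bar>x\<bar> ^ 3))" for c
  have int_min: "integrable \<mu> (\<lambda>x. min (6 * x\<^sup>2) (c * \<bar>x\<bar> ^ 3))" if "c \<ge> 0" for c :: real
    by (rule Bochner_Integration.integrable_bound[of _ "\<lambda>x. 6 * x\<^sup>2"])
      (use sq_int that in \<open>auto simp: min_def\<close>)
  \<comment> \<open>Monotonicity lets one remainder, at
    \<open>\<bar>t\<bar> * \<bar>b n\<bar>\<close>, serve all indices \<open>i\<close> at
    once.\<close>
  have E_mono: "E c \<le> E c'" if "0 \<le> c" "c \<le> c'" for c c'
    unfolding E_def
  proof (rule integral_mono)
    show "min (6 * x\<^sup>2) (c * \<bar>x\<bar> ^ 3) \<le> min (6 * x\<^sup>2) (c' * \<bar>x\<bar> ^ 3)" for x :: real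
      using that by (intro min.mono mult_right_mono order_refl) simp_all
  qed (use that in \<open>simp_all add: int_min\<close>)
  have E_lim: "(\<lambda>n. E (\<bar>t\<bar> * \<bar>b n\<bar>)) \<longlonglongrightarrow> 0"
  proof -
    \<comment> \<open>Dominated convergence: the integrand tends to 0 pointwise because
      \<open>b\<close> does, and the quadratic term of the minimum is an integrable
      majorant.\<close>
    have "(\<lambda>n. LINT x|\<mu>. min (6 * x\<^sup>2) (\<bar>t\<bar> * \<bar>b n\<bar> * \<bar>x\<bar> ^ 3)) \<longlonglongrightarrow> (LINT x|\<mu>. 0)"
    proof (rule integral_dominated_convergence[where w = "\<lambda>x. 6 * x\<^sup>2"])
      have "(\<lambda>n. min (6 * x\<^sup>2) (\<bar>t\<bar> * \<bar>b n\<bar> * \<bar>x\<bar> ^ 3)) \<longlonglongrightarrow> min (6 * x\<^sup>2) (\<bar>t\<bar> * \<bar>0\<bar> * \<bar>x\<bar> ^ 3)" for x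
        by (intro tendsto_intros b)
      then show "AE x in \<mu>. (\<lambda>n. min (6 * x\<^sup>2) (\<bar>t\<bar> * \<bar>b n\<bar> * \<bar>x\<bar> ^ 3)) \<longlonglongrightarrow> 0"
        by (simp add: min_absorb2)
    qed (use sq_int in \<open>auto simp: min_def\<close>)
    then show ?thesis by (simp add: E_def)
  qed
  define \<phi> where "\<phi> n = char (distr (M n) borel (\<lambda>\<omega>. \<Sum>i\<in>I n. a n i * X n i \<omega>)) t" for n
  define g where "g v = exp (- (s * v\<^sup>2 / 2))" for v :: real
  have \<phi>_eq: "\<phi> n = (\<Prod>i\<in>I n. char \<mu> (t * a n i))" for n
  proof -
    have "prob_space.indep_vars (M n) (\<lambda>_. borel) (\<lambda>i \<omega>. a n i * X n i \<omega>) (I n)"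
      by (rule prob_space.indep_vars_compose2[OF prob indep]) auto
    then show ?thesis
      by (simp add: \<phi>_def prob_space.char_distr_sum[OF prob] char_distr_mult distr cong: prod.cong)
  qed
  have factor: "cmod (char \<mu> (t * a n i) - g (t * a n i))
      \<le> (a n i)\<^sup>2 * (t\<^sup>2 / 6 * E (\<bar>t\<bar> * \<bar>b n\<bar>) + s\<^sup>2 * t ^ 4 / 4 * (b n)\<^sup>2)"
    if i: "i \<in> I n" for n i
  proof -
    define v where "v = t * a n i"
    have a_b: "\<bar>a n i\<bar> \<le> \<bar>b n\<bar>" using bound[OF i] by simp
    have "cmod (char \<mu> v - (1 - v\<^sup>2 * s / 2)) \<le> v\<^sup>2 / 6 * E \<bar>v\<bar>"
      using \<mu>.char_approx3[OF int1 _ sq_int, of s v] mean var by (simp add: E_def)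
    also have "\<dots> \<le> v\<^sup>2 / 6 * E (\<bar>t\<bar> * \<bar>b n\<bar>)"
      using a_b by (intro mult_left_mono E_mono) (auto simp: v_def abs_mult intro: mult_left_mono)
    finally have 1: "cmod (char \<mu> v - (1 - v\<^sup>2 * s / 2)) \<le> v\<^sup>2 / 6 * E (\<bar>t\<bar> * \<bar>b n\<bar>)" .
    have "\<bar>g v - (1 - v\<^sup>2 * s / 2)\<bar> \<le> (s * v\<^sup>2 / 2)\<^sup>2"
      using exp_minus_approx[of "s * v\<^sup>2 / 2"] s by (simp add: g_def mult_ac)
    \<comment> \<open>One factor \<open>(a n i)\<^sup>2\<close> is kept, because these sum to 1 over
      \<open>i\<close>; only the other one is replaced by \<open>(b n)\<^sup>2\<close>.\<close>
    also have "\<dots> = (a n i)\<^sup>2 * (s\<^sup>2 * t ^ 4 / 4 * (a n i)\<^sup>2)"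
      by (simp add: v_def power2_eq_square power4_eq_xxxx)
    also have "\<dots> \<le> (a n i)\<^sup>2 * (s\<^sup>2 * t ^ 4 / 4 * (b n)\<^sup>2)"
      using a_b by (intro mult_left_mono) (auto simp: abs_le_square_iff)
    finally have 2: "\<bar>g v - (1 - v\<^sup>2 * s / 2)\<bar> \<le> (a n i)\<^sup>2 * (s\<^sup>2 * t ^ 4 / 4 * (b n)\<^sup>2)" .
    have "cmod (char \<mu> v - g v)
        \<le> cmod (char \<mu> v - (1 - v\<^sup>2 * s / 2)) + cmod (of_real (g v - (1 - v\<^sup>2 * s / 2)))"
      using norm_triangle_ineq4[of "char \<mu> v - (1 - v\<^sup>2 * s / 2)" "of_real (g v - (1 - v\<^sup>2 * s / 2))"]
      by simp
    also have "\<dots> \<le> v\<^sup>2 / 6 * E (\<bar>t\<bar> * \<bar>b n\<bar>) + (a n i)\<^sup>2 * (s\<^sup>2 * t ^ 4 / 4 * (b n)\<^sup>2)"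
      using 1 2 unfolding norm_of_real by linarith
    also have "\<dots> = (a n i)\<^sup>2 * (t\<^sup>2 / 6 * E (\<bar>t\<bar> * \<bar>b n\<bar>) + s\<^sup>2 * t ^ 4 / 4 * (b n)\<^sup>2)"
      by (simp add: v_def power_mult_distrib algebra_simps)
    finally show ?thesis unfolding v_def .
  qed
  have prod_g: "(\<Prod>i\<in>I n. complex_of_real (g (t * a n i))) = char (normal_law 0 s) t" for n
  proof -
    \<comment> \<open>Over an infinite index set the sum has the default value 0, which contradicts
      \<open>weights\<close>.\<close>
    have fin: "finite (I n)"
      using weights[of n] by (rule_tac ccontr) simp
    \<comment> \<open>The exponents add up, and since the squared weights sum to 1 the Gaussian
      factors multiply exactly to the limit, for every \<open>n\<close>.\<close>
    have "(\<Prod>i\<in>I n. g (t * a n i)) = exp (\<Sum>i\<in>I n. - (s * (t * a n i)\<^sup>2 / 2))"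
      by (simp add: g_def exp_sum fin)
    also have "(\<Sum>i\<in>I n. - (s * (t * a n i)\<^sup>2 / 2)) = - (s * t\<^sup>2 / 2) * (\<Sum>i\<in>I n. (a n i)\<^sup>2)"
      unfolding sum_distrib_left by (intro sum.cong) (auto simp: power_mult_distrib)
    finally show ?thesis
      by (simp add: weights char_normal_law[OF s] flip: of_real_prod)
  qed
  have diff_bound: "norm (\<phi> n - char (normal_law 0 s) t)
      \<le> t\<^sup>2 / 6 * E (\<bar>t\<bar> * \<bar>b n\<bar>) + s\<^sup>2 * t ^ 4 / 4 * (b n)\<^sup>2" for n
  proof -
    \<comment> \<open>Exchanging the factors one at a time costs at most the sum of their
      differences, as all of them have norm at most 1.\<close>
    have "norm (\<phi> n - char (normal_law 0 s) t)
        \<le> (\<Sum>i\<in>I n. norm (char \<mu> (t * a n i) - of_real (g (t * a n i))))"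
      unfolding \<phi>_eq prod_g[of n, symmetric]
      by (rule norm_prod_diff) (use s in \<open>auto simp: \<mu>.cmod_char_le_1 g_def\<close>)
    also have "\<dots> \<le> (\<Sum>i\<in>I n. (a n i)\<^sup>2 *
        (t\<^sup>2 / 6 * E (\<bar>t\<bar> * \<bar>b n\<bar>) + s\<^sup>2 * t ^ 4 / 4 * (b n)\<^sup>2))"
      by (intro sum_mono factor)
    also have "\<dots> = t\<^sup>2 / 6 * E (\<bar>t\<bar> * \<bar>b n\<bar>) + s\<^sup>2 * t ^ 4 / 4 * (b n)\<^sup>2"
      by (simp add: weights flip: sum_distrib_right)
    finally show ?thesis .
  qed
  have "(\<lambda>n. t\<^sup>2 / 6 * E (\<bar>t\<bar> * \<bar>b n\<bar>) + s\<^sup>2 * t ^ 4 / 4 * (b n)\<^sup>2) \<longlonglongrightarrow>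
      t\<^sup>2 / 6 * 0 + s\<^sup>2 * t ^ 4 / 4 * 0\<^sup>2"
    by (intro tendsto_intros E_lim b)
  then have "(\<lambda>n. t\<^sup>2 / 6 * E (\<bar>t\<bar> * \<bar>b n\<bar>) + s\<^sup>2 * t ^ 4 / 4 * (b n)\<^sup>2) \<longlonglongrightarrow> 0"
    by simp
  with always_eventually[OF allI[OF diff_bound]]
  have "(\<lambda>n. \<phi> n - char (normal_law 0 s) t) \<longlonglongrightarrow> 0"
    by (rule Lim_null_comparison)
  then show "(\<lambda>n. char (distr (M n) borel (\<lambda>\<omega>. \<Sum>i\<in>I n. a n i * X n i \<omega>)) t)
      \<longlonglongrightarrow> char (normal_law 0 s) t"
    unfolding \<phi>_def by (rule Lim_null[THEN iffD2])
qed

section \<open>Moments of the uniform law\<close>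

lemma uniform_symmetric_moments:
  fixes \<theta> :: real
  assumes "\<theta> > 0"
  defines "\<mu> \<equiv> uniform_measure lborel {- \<theta>..\<theta>}"
  shows "real_distribution \<mu>"
    and "integrable \<mu> (\<lambda>x. x\<^sup>2)"
    and "(LINT x|\<mu>. x) = 0"
    and "(LINT x|\<mu>. x\<^sup>2) = \<theta>\<^sup>2 / 3"
proof -
  interpret prob_space \<mu>
    unfolding \<mu>_def using assms by (intro prob_space_uniform_measure) auto
  have [simp, measurable_cong]: "sets \<mu> = sets borel"
    by (simp add: \<mu>_def)
  show "real_distribution \<mu>"
    by unfold_locales simp
  \<comment> \<open>Viewing the identity as a uniformly distributed variable gives access to the
    known expectation and variance of such variables.\<close>
  have D: "distributed \<mu> lborel (\<lambda>x. x)
      (\<lambda>x. indicator {- \<theta>..\<theta>} x / measure lborel {- \<theta>..\<theta>})"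
  proof -
    have "distr \<mu> lborel (\<lambda>x. x) = \<mu>"
      by (rule distr_id2) simp
    also have "\<dots> = density lborel (\<lambda>x. indicator {- \<theta>..\<theta>} x / measure lborel {- \<theta>..\<theta>})"
      unfolding \<mu>_def uniform_measure_def using assms
      by (intro density_cong)
        (auto simp: divide_ennreal ennreal_indicator split: split_indicator simp flip: ennreal_1 ennreal_numeral)
    finally show ?thesis
      unfolding distributed_def by auto
  qed
  show mean: "(LINT x|\<mu>. x) = 0"
    using uniform_distributed_expectation[OF D] by simp
  \<comment> \<open>The mean is zero, so the second moment is the variance (2 \<theta>)^2 /
    12.\<close>
  show "(LINT x|\<mu>. x\<^sup>2) = \<theta>\<^sup>2 / 3"
    using uniform_distributed_variance[OF D] by (simp add: mean power2_eq_square)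
  have "AE x in \<mu>. x \<in> {- \<theta>..\<theta>}"
    unfolding \<mu>_def by (intro AE_uniform_measureI) auto
  then have "AE x in \<mu>. norm (x\<^sup>2) \<le> \<theta>\<^sup>2"
    by eventually_elim (use assms in \<open>auto simp: abs_le_square_iff[symmetric]\<close>)
  then show "integrable \<mu> (\<lambda>x. x\<^sup>2)"
    by (rule integrable_const_bound) simp
qed

section \<open>The least squares estimator\<close>

text \<open>Expanding the square gives n S2^2 - 2 S1^2 S2 + S1^2 S2, which factors. This is what
  normalises the weights in the error of the intercept.\<close>

lemma sum_p_coef_sq: "(\<Sum>k<dim_vec x. (p_coef x k)\<^sup>2) = S2 x * d_coef x"
proof -
  have "(\<Sum>k<dim_vec x. (p_coef x k)\<^sup>2) =
      (\<Sum>k<dim_vec x. (S2 x)\<^sup>2 - 2 * S2 x * S1 x * x $ k + (S1 x)\<^sup>2 * (x $ k)\<^sup>2)"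
    by (intro sum.cong) (auto simp: p_coef_def power2_eq_square algebra_simps)
  also have "\<dots> = real (dim_vec x) * (S2 x)\<^sup>2 - 2 * S2 x * S1 x * S1 x + (S1 x)\<^sup>2 * S2 x"
    by (simp add: sum.distrib sum_subtractf S1_def S2_def flip: sum_distrib_left)
  finally show ?thesis
    by (simp add: d_coef_def power2_eq_square algebra_simps)
qed

text \<open>The counterpart for the slope; it also yields the positivity of
  \<open>d_coef\<close>.\<close>

lemma sum_p'_coef_sq: "(\<Sum>k<dim_vec x. (p'_coef x k)\<^sup>2) = real (dim_vec x) * d_coef x"
proof -
  have "(\<Sum>k<dim_vec x. (p'_coef x k)\<^sup>2) =
      (\<Sum>k<dim_vec x. (dim_vec x)\<^sup>2 * (x $ k)\<^sup>2 - 2 * real (dim_vec x) * S1 x * x $ k + (S1 x)\<^sup>2)"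
    by (intro sum.cong) (auto simp: p'_coef_def power2_eq_square algebra_simps)
  also have "\<dots> = (dim_vec x)\<^sup>2 * S2 x - 2 * real (dim_vec x) * S1 x * S1 x + dim_vec x * (S1 x)\<^sup>2"
    by (simp add: sum.distrib sum_subtractf S1_def S2_def flip: sum_distrib_left)
  finally show ?thesis
    by (simp add: d_coef_def power2_eq_square algebra_simps)
qed

lemma S2_pos:
  assumes "\<not> (\<exists>c. x = c \<cdot>\<^sub>v ones_vec (dim_vec x))"
  shows "S2 x > 0"
proof (rule ccontr)
  assume "\<not> S2 x > 0"
  moreover have "S2 x \<ge> 0"
    unfolding S2_def by (intro sum_nonneg) simp
  ultimately have "\<forall>i<dim_vec x. x $ i = 0"
    unfolding S2_def by (simp add: sum_nonneg_eq_0_iff)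
  then have "x = 0 \<cdot>\<^sub>v ones_vec (dim_vec x)"
    by (intro eq_vecI) (auto simp: ones_vec_def)
  with assms show False by blast
qed

text \<open>This is the strict case of Cauchy-Schwarz for \<open>x\<close> and the vector of ones.
  The sum of the squared \<open>p'_coef\<close> is n times \<open>d_coef x\<close>; if it vanished,
  every entry of \<open>x\<close> would equal the mean \<open>S1 x / dim_vec x\<close>.\<close>

lemma d_coef_pos:
  assumes "\<not> (\<exists>c. x = c \<cdot>\<^sub>v ones_vec (dim_vec x))" and "dim_vec x > 0"
  shows "d_coef x > 0"
proof (rule ccontr)
  assume "\<not> d_coef x > 0"
  then have "(\<Sum>k<dim_vec x. (p'_coef x k)\<^sup>2) \<le> 0"
    by (simp add: sum_p'_coef_sq mult_nonneg_nonpos)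
  then have "(\<Sum>k<dim_vec x. (p'_coef x k)\<^sup>2) = 0"
    by (intro antisym sum_nonneg) auto
  then have "\<forall>k<dim_vec x. p'_coef x k = 0"
    by (simp add: sum_nonneg_eq_0_iff)
  then have "x = (S1 x / dim_vec x) \<cdot>\<^sub>v ones_vec (dim_vec x)"
    using assms(2) by (intro eq_vecI) (auto simp: ones_vec_def p'_coef_def eq_divide_eq mult.commute)
  with assms(1) show False by blast
qed

section \<open>Gram matrix and normal equations\<close>

lemma design_mat_carrier: "design_mat x \<in> carrier_mat (dim_vec x) 2"
  by (simp add: design_mat_def mat_of_cols_def carrier_matI)

lemma gram_design_mat:
  "(design_mat x)\<^sup>T * design_mat x =
    mat 2 2 (\<lambda>(i, j). if i = 0 \<and> j = 0 then real (dim_vec x) else if i = 1 \<and> j = 1 then S2 x else S1 x)"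
  by (intro eq_matI)
    (auto simp: design_mat_def mat_of_cols_def scalar_prod_def ones_vec_def S1_def S2_def
      less_2_cases_iff lessThan_atLeast0 power2_eq_square)

text \<open>Cramer's rule for the 2 by 2 Gram matrix, whose determinant is \<open>d_coef x\<close>.
  Keeping the determinant on the left avoids any division.\<close>

lemma normal_equations_solution:
  assumes u: "u \<in> carrier_vec 2" and e: "e \<in> carrier_vec (dim_vec x)"
    and eq: "((design_mat x)\<^sup>T * design_mat x) *\<^sub>v u = (design_mat x)\<^sup>T *\<^sub>v e"
  shows "d_coef x * u $ 0 = (\<Sum>k<dim_vec x. p_coef x k * e $ k)"
    and "d_coef x * u $ 1 = (\<Sum>k<dim_vec x. p'_coef x k * e $ k)"
proof -
  define w0 w1 where "w0 = (\<Sum>k<dim_vec x. e $ k)" and "w1 = (\<Sum>k<dim_vec x. x $ k * e $ k)"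
  have X0: "((design_mat x)\<^sup>T *\<^sub>v e) $ 0 = w0" and X1: "((design_mat x)\<^sup>T *\<^sub>v e) $ 1 = w1"
    using e by (auto simp: design_mat_def mat_of_cols_def scalar_prod_def ones_vec_def w0_def w1_def
        lessThan_atLeast0)
  have G: "real (dim_vec x) * u $ 0 + S1 x * u $ 1 = w0" "S1 x * u $ 0 + S2 x * u $ 1 = w1"
    using u arg_cong[OF eq, of "\<lambda>v. v $ 0"] arg_cong[OF eq, of "\<lambda>v. v $ 1"]
    unfolding gram_design_mat X0 X1
    by (auto simp: scalar_prod_def numeral_2_eq_2)
  \<comment> \<open>The two sums are the Cramer numerators, the adjugate of the Gram matrix applied
    to \<open>(w0, w1)\<close>.\<close>
  have p: "(\<Sum>k<dim_vec x. p_coef x k * e $ k) = S2 x * w0 - S1 x * w1"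
    unfolding w0_def w1_def sum_distrib_left sum_subtractf[symmetric]
    by (intro sum.cong) (auto simp: p_coef_def algebra_simps)
  have p': "(\<Sum>k<dim_vec x. p'_coef x k * e $ k) = real (dim_vec x) * w1 - S1 x * w0"
    unfolding w0_def w1_def sum_distrib_left sum_subtractf[symmetric]
    by (intro sum.cong) (auto simp: p'_coef_def algebra_simps)
  show "d_coef x * u $ 0 = (\<Sum>k<dim_vec x. p_coef x k * e $ k)"
    unfolding p G[symmetric] by (simp add: d_coef_def power2_eq_square algebra_simps)
  show "d_coef x * u $ 1 = (\<Sum>k<dim_vec x. p'_coef x k * e $ k)"
    unfolding p' G[symmetric] by (simp add: d_coef_def power2_eq_square algebra_simps)
qed

text \<open>\<open>mat_inverse\<close> returns \<open>None\<close> only on non-units of the matrix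
  ring, so an explicit two-sided inverse suffices to exclude that case.\<close>

lemma mat_inverse_gram_design_mat:
  assumes "d_coef x \<noteq> 0"
  defines "G \<equiv> (design_mat x)\<^sup>T * design_mat x"
  obtains B where "mat_inverse G = Some B" "G * B = 1\<^sub>m 2" "B \<in> carrier_mat 2 2"
proof -
  \<comment> \<open>The adjugate divided by the determinant \<open>d_coef x\<close>.\<close>
  define C where "C = mat 2 2 (\<lambda>(i, j). (if i = 0 \<and> j = 0 then S2 x
    else if i = 1 \<and> j = 1 then real (dim_vec x) else - S1 x) / d_coef x)"
  have G: "G \<in> carrier_mat 2 2" and C: "C \<in> carrier_mat 2 2"
    by (simp_all add: G_def gram_design_mat C_def)
  have d: "real (dim_vec x) * S2 x - S1 x * S1 x = d_coef x"
    by (simp add: d_coef_def power2_eq_square)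
  have "G * C = 1\<^sub>m 2" "C * G = 1\<^sub>m 2"
    using assms(1) d unfolding G_def gram_design_mat C_def
    by (auto intro!: eq_matI simp: scalar_prod_def less_2_cases_iff numeral_2_eq_2 algebra_simps
        simp flip: diff_divide_distrib add_divide_distrib)
  then have "G \<in> Units (ring_mat TYPE(real) 2 ())"
    using G C unfolding Units_def ring_mat_def by auto
  then obtain B where "mat_inverse G = Some B"
    using mat_inverse(1)[OF G, of "()"] by (cases "mat_inverse G") auto
  with mat_inverse(2)[OF G] that show thesis by blast
qed

text \<open>The estimator solves the normal equations for the response. Subtracting the Gram matrix
  times \<beta> leaves the normal equations for \<beta>' - \<beta> with the noise \<open>e\<close>
  as data, and Cramer's rule applies.\<close>

lemma ols_estimator_error:
  assumes d: "d_coef x \<noteq> 0" and \<beta>: "\<beta> \<in> carrier_vec 2" and e: "e \<in> carrier_vec (dim_vec x)"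
  defines "\<beta>' \<equiv> ols_estimator (design_mat x) (design_mat x *\<^sub>v \<beta> + e)"
  shows "\<beta>' $ 0 - \<beta> $ 0 = (\<Sum>k<dim_vec x. p_coef x k * e $ k) / d_coef x"
    and "\<beta>' $ 1 - \<beta> $ 1 = (\<Sum>k<dim_vec x. p'_coef x k * e $ k) / d_coef x"
proof -
  let ?X = "design_mat x" and ?Y = "design_mat x *\<^sub>v \<beta> + e"
  let ?G = "?X\<^sup>T * ?X"
  note X = design_mat_carrier[of x]
  have XT: "?X\<^sup>T \<in> carrier_mat 2 (dim_vec x)" and G: "?G \<in> carrier_mat 2 2"
    using X by auto
  have Y: "?Y \<in> carrier_vec (dim_vec x)"
    using X \<beta> e by simp
  obtain B where B: "mat_inverse ?G = Some B" "?G * B = 1\<^sub>m 2" "B \<in> carrier_mat 2 2"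
    using mat_inverse_gram_design_mat[OF d] .
  have \<beta>'_eq: "\<beta>' = B *\<^sub>v (?X\<^sup>T *\<^sub>v ?Y)"
    using B(1,3) XT Y by (simp add: \<beta>'_def ols_estimator_def)
  have \<beta>': "\<beta>' \<in> carrier_vec 2"
    using B(3) XT Y by (simp add: \<beta>'_eq)
  have XTY: "?X\<^sup>T *\<^sub>v ?Y \<in> carrier_vec 2"
    using XT Y by simp
  have "?G *\<^sub>v \<beta>' = ?X\<^sup>T *\<^sub>v ?Y"
    using assoc_mult_mat_vec[OF G B(3) XTY] XTY by (simp add: \<beta>'_eq B(2))
  also have "\<dots> = ?G *\<^sub>v \<beta> + ?X\<^sup>T *\<^sub>v e"
    using mult_add_distrib_mat_vec[OF XT _ e, of "?X *\<^sub>v \<beta>"] assoc_mult_mat_vec[OF XT X \<beta>] X \<beta> by simp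
  finally have "?G *\<^sub>v (\<beta>' - \<beta>) = ?X\<^sup>T *\<^sub>v e"
    using mult_minus_distrib_mat_vec[OF G \<beta>' \<beta>] G XT \<beta> e by (auto intro!: eq_vecI)
  from normal_equations_solution[OF _ e this]
  show "\<beta>' $ 0 - \<beta> $ 0 = (\<Sum>k<dim_vec x. p_coef x k * e $ k) / d_coef x"
    and "\<beta>' $ 1 - \<beta> $ 1 = (\<Sum>k<dim_vec x. p'_coef x k * e $ k) / d_coef x"
    using d \<beta> \<beta>' by (auto simp: field_simps)
qed

section \<open>Asymptotic normality of the two errors\<close>

text \<open>Common core of both claims: \<open>q\<close> stands for \<open>p_coef\<close> or
  \<open>p'_coef\<close>, and \<open>D\<close> for the sum of its squares, so that q / sqrt D are
  admissible weights for \<open>weighted_sum_clt\<close>.\<close>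

lemma converges_in_law_weighted_uniform:
  fixes M :: "nat \<Rightarrow> 'a measure" and \<epsilon> :: "nat \<Rightarrow> 'a \<Rightarrow> real vec"
    and q :: "nat \<Rightarrow> nat \<Rightarrow> real" and D :: "nat \<Rightarrow> real"
  assumes theta: "\<theta> > 0"
    and prob: "\<And>n. n \<ge> 2 \<Longrightarrow> prob_space (M n)"
    and indep: "\<And>n. n \<ge> 2 \<Longrightarrow>
      prob_space.indep_vars (M n) (\<lambda>_. borel) (\<lambda>i \<omega>. \<epsilon> n \<omega> $ i) {..<n}"
    and uniform: "\<And>n i. n \<ge> 2 \<Longrightarrow> i < n \<Longrightarrow>
      distr (M n) borel (\<lambda>\<omega>. \<epsilon> n \<omega> $ i) = uniform_measure lborel {-\<theta>..\<theta>}"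
    and D: "\<And>n. n \<ge> 2 \<Longrightarrow> D n > 0"
    and sum_sq: "\<And>n. n \<ge> 2 \<Longrightarrow> (\<Sum>i<n. (q n i)\<^sup>2) = D n"
    and max: "(\<lambda>n. (MAX i\<in>{..<n}. \<bar>q n i\<bar>) / sqrt (D n)) \<longlonglongrightarrow> 0"
    and Z: "\<And>n \<omega>. n \<ge> 2 \<Longrightarrow> \<omega> \<in> space (M n) \<Longrightarrow>
      Z n \<omega> = (\<Sum>i<n. q n i / sqrt (D n) * \<epsilon> n \<omega> $ i)"
  shows "converges_in_law M Z (normal_law 0 (\<theta>\<^sup>2 / 3))"
proof -
  \<comment> \<open>The hypotheses hold only from sample size 2 on, while
    \<open>weighted_sum_clt\<close> asks for them at every index. It is therefore applied to the
    sequence shifted by 2, which has the same limit.\<close>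
  have "weak_conv_m (\<lambda>n. distr (M (n + 2)) borel
      (\<lambda>\<omega>. \<Sum>i<n + 2. q (n + 2) i / sqrt (D (n + 2)) * \<epsilon> (n + 2) \<omega> $ i)) (normal_law 0 (\<theta>\<^sup>2 / 3))"
  proof (rule weighted_sum_clt[where \<mu> = "uniform_measure lborel {-\<theta>..\<theta>}"
        and b = "\<lambda>n. (MAX i\<in>{..<n + 2}. \<bar>q (n + 2) i\<bar>) / sqrt (D (n + 2))"])
    show "(\<Sum>i<n + 2. (q (n + 2) i / sqrt (D (n + 2)))\<^sup>2) = 1" for n
      using D[of "n + 2"] sum_sq[of "n + 2"] by (simp add: power_divide flip: sum_divide_distrib)
    show "\<bar>q (n + 2) i / sqrt (D (n + 2))\<bar> \<le> (MAX i\<in>{..<n + 2}. \<bar>q (n + 2) i\<bar>) / sqrt (D (n + 2))"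
      if "i \<in> {..<n + 2}" for n i
      using that D[of "n + 2"] by (auto simp: abs_divide intro!: divide_right_mono Max_ge)
    show "(\<lambda>n. (MAX i\<in>{..<n + 2}. \<bar>q (n + 2) i\<bar>) / sqrt (D (n + 2))) \<longlonglongrightarrow> 0"
      using LIMSEQ_ignore_initial_segment[OF max, of 2] .
    show "\<theta>\<^sup>2 / 3 > 0"
      using theta by simp
    show "(LINT x|uniform_measure lborel {-\<theta>..\<theta>}. x\<^sup>2) = \<theta>\<^sup>2 / 3"
      by (rule uniform_symmetric_moments(4)[OF theta])
  qed (simp_all add: theta prob indep uniform uniform_symmetric_moments(1-3)[OF theta])
  also have "(\<lambda>n. distr (M (n + 2)) borel
      (\<lambda>\<omega>. \<Sum>i<n + 2. q (n + 2) i / sqrt (D (n + 2)) * \<epsilon> (n + 2) \<omega> $ i)) =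
      (\<lambda>n. distr (M (n + 2)) borel (Z (n + 2)))"
    by (intro ext distr_cong) (simp_all add: Z)
  finally show ?thesis
    unfolding converges_in_law_def weak_conv_m_def weak_conv_def
    by (auto intro: LIMSEQ_offset[where k = 2])
qed

theorem theorem2p2:
  fixes \<theta> :: real and \<beta> :: "real vec"
    and x :: "nat \<Rightarrow> real vec"
    and M :: "nat \<Rightarrow> 'a measure"
    and \<epsilon> Y \<beta>hat :: "nat \<Rightarrow> 'a \<Rightarrow> real vec"
  assumes theta: "\<theta> > 0"
    and beta: "\<beta> \<in> carrier_vec 2"
    and x_dim: "\<And>n. n \<ge> 2 \<Longrightarrow> x n \<in> carrier_vec n"
    and x_not_collinear: "\<And>n. n \<ge> 2 \<Longrightarrow> \<not> (\<exists>c. x n = c \<cdot>\<^sub>v ones_vec n)"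
    and prob: "\<And>n. n \<ge> 2 \<Longrightarrow> prob_space (M n)"
    and eps_dim: "\<And>n \<omega>. n \<ge> 2 \<Longrightarrow> \<omega> \<in> space (M n) \<Longrightarrow> \<epsilon> n \<omega> \<in> carrier_vec n"
    and eps_indep: "\<And>n. n \<ge> 2 \<Longrightarrow>
      prob_space.indep_vars (M n) (\<lambda>_. borel) (\<lambda>i \<omega>. \<epsilon> n \<omega> $ i) {..<n}"
    and eps_uniform: "\<And>n i. n \<ge> 2 \<Longrightarrow> i < n \<Longrightarrow>
      distr (M n) borel (\<lambda>\<omega>. \<epsilon> n \<omega> $ i) = uniform_measure lborel {-\<theta>..\<theta>}"
    and Y: "\<And>n \<omega>. n \<ge> 2 \<Longrightarrow> \<omega> \<in> space (M n) \<Longrightarrow>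
      Y n \<omega> = design_mat (x n) *\<^sub>v \<beta> + \<epsilon> n \<omega>"
    and beta_hat: "\<And>n \<omega>. n \<ge> 2 \<Longrightarrow> \<omega> \<in> space (M n) \<Longrightarrow>
      \<beta>hat n \<omega> = ols_estimator (design_mat (x n)) (Y n \<omega>)"
  shows
    "((\<lambda>n. (MAX i\<in>{..<n}. \<bar>p_coef (x n) i\<bar>) / sqrt (d_coef (x n) * S2 (x n)))
        \<longlonglongrightarrow> 0 \<longrightarrow>
      converges_in_law M (\<lambda>n \<omega>. sqrt (d_coef (x n) / S2 (x n)) * (\<beta>hat n \<omega> $ 0 - \<beta> $ 0))
        (normal_law 0 (\<theta>\<^sup>2 / 3)))
     \<and>
     ((\<lambda>n. (MAX i\<in>{..<n}. \<bar>p'_coef (x n) i\<bar>) / sqrt (d_coef (x n) * real n))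
        \<longlonglongrightarrow> 0 \<longrightarrow>
      converges_in_law M (\<lambda>n \<omega>. sqrt (d_coef (x n) / real n) * (\<beta>hat n \<omega> $ 1 - \<beta> $ 1))
        (normal_law 0 (\<theta>\<^sup>2 / 3)))"
proof (intro conjI impI)
  have dim: "dim_vec (x n) = n" if "n \<ge> 2" for n
    using x_dim[OF that] by auto
  have d: "d_coef (x n) > 0" and S2: "S2 (x n) > 0" if "n \<ge> 2" for n
    using x_not_collinear[OF that] dim[OF that] that d_coef_pos[of "x n"] S2_pos[of "x n"] by auto
  have err: "\<beta>hat n \<omega> $ 0 - \<beta> $ 0 = (\<Sum>k<n. p_coef (x n) k * \<epsilon> n \<omega> $ k) / d_coef (x n)"
    "\<beta>hat n \<omega> $ 1 - \<beta> $ 1 = (\<Sum>k<n. p'_coef (x n) k * \<epsilon> n \<omega> $ k) / d_coef (x n)"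
    if "n \<ge> 2" "\<omega> \<in> space (M n)" for n \<omega>
    using ols_estimator_error[of "x n" \<beta> "\<epsilon> n \<omega>"] d[of n] beta eps_dim[OF that] dim[of n]
      Y[OF that] beta_hat[OF that] that by auto
  have sum_sq: "(\<Sum>i<n. (p_coef (x n) i)\<^sup>2) = d_coef (x n) * S2 (x n)"
    "(\<Sum>i<n. (p'_coef (x n) i)\<^sup>2) = d_coef (x n) * real n" if "n \<ge> 2" for n
    using sum_p_coef_sq[of "x n"] sum_p'_coef_sq[of "x n"]
    unfolding dim[OF that]
    by (simp_all only: mult.commute)
  \<comment> \<open>As D is the square of sqrt D, the prescribed scaling turns the division by
    \<open>d_coef\<close> into division by the root of the sum of squares.\<close>
  have scale: "sqrt (D / c) * (s / D) = s / sqrt (D * c)" if "D > 0" for c D s :: real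
    using that real_sqrt_mult_self[of D]
    by (simp add: real_sqrt_divide real_sqrt_mult divide_simps)
  show "converges_in_law M
      (\<lambda>n \<omega>. sqrt (d_coef (x n) / S2 (x n)) * (\<beta>hat n \<omega> $ 0 - \<beta> $ 0)) (normal_law 0 (\<theta>\<^sup>2 / 3))"
    if max: "(\<lambda>n. (MAX i\<in>{..<n}. \<bar>p_coef (x n) i\<bar>) / sqrt (d_coef (x n) * S2 (x n))) \<longlonglongrightarrow> 0"
  proof (rule converges_in_law_weighted_uniform[OF theta prob eps_indep eps_uniform _ _ max])
    fix n assume n: "n \<ge> (2 :: nat)"
    show "d_coef (x n) * S2 (x n) > 0"
      using d[OF n] S2[OF n] n by simp
    show "(\<Sum>i<n. (p_coef (x n) i)\<^sup>2) = d_coef (x n) * S2 (x n)"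
      by (rule sum_sq[OF n])
    show "sqrt (d_coef (x n) / S2 (x n)) * (\<beta>hat n \<omega> $ 0 - \<beta> $ 0) =
        (\<Sum>i<n. p_coef (x n) i / sqrt (d_coef (x n) * S2 (x n)) * \<epsilon> n \<omega> $ i)"
      if "\<omega> \<in> space (M n)" for \<omega>
      unfolding err[OF n that] scale[OF d[OF n]] by (simp add: sum_divide_distrib)
  qed
  show "converges_in_law M
      (\<lambda>n \<omega>. sqrt (d_coef (x n) / real n) * (\<beta>hat n \<omega> $ 1 - \<beta> $ 1)) (normal_law 0 (\<theta>\<^sup>2 / 3))"
    if max: "(\<lambda>n. (MAX i\<in>{..<n}. \<bar>p'_coef (x n) i\<bar>) / sqrt (d_coef (x n) * real n)) \<longlonglongrightarrow> 0"
  proof (rule converges_in_law_weighted_uniform[OF theta prob eps_indep eps_uniform _ _ max])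
    fix n assume n: "n \<ge> (2 :: nat)"
    show "d_coef (x n) * real n > 0"
      using d[OF n] S2[OF n] n by simp
    show "(\<Sum>i<n. (p'_coef (x n) i)\<^sup>2) = d_coef (x n) * real n"
      by (rule sum_sq[OF n])
    show "sqrt (d_coef (x n) / real n) * (\<beta>hat n \<omega> $ 1 - \<beta> $ 1) =
        (\<Sum>i<n. p'_coef (x n) i / sqrt (d_coef (x n) * real n) * \<epsilon> n \<omega> $ i)"
      if "\<omega> \<in> space (M n)" for \<omega>
      unfolding err[OF n that] scale[OF d[OF n]] by (simp add: sum_divide_distrib)
  qed
qed

end
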